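(* Let $(\alpha_i,\beta_i)$, $i\ge1$, be an arbitrary interval from the representation $$\{t\ge0\mid Y(t)>0\}=[\alpha_0,\beta_0)\cup\Big(\bigcup_{i=1}^N(\alpha_i,\beta_i)\Big)$$ of the positivity set of $Y$, and consider the fractional Cox–Ingersoll–Ross process $X(t)=Y^2(t)$, $t\in[\alpha_i,\beta_i]$. Then, for $\alpha_i\le t\le\beta_i$, the process $X$ almost surely satisfies the SDE $$dX(t)=(k-aX(t))\,dt+\sigma\sqrt{X(t)}\circ dB^H(t),\qquad X(\alpha_i)=0,$$ that is, $X(t)=\int_{\alpha_i}^t(k-aX(s))\,ds+\sigma\int_{\alpha_i}^t\sqrt{X(s)}\circ dB^H(s)$ for $t\in[\alpha_i,\beta_i]$, where the integral with respect to the fractional Brownian motion is the pathwise Stratonovich integral.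
   Context: $B^H=\{B^H(t),t\ge0\}$ is a fractional Brownian motion with Hurst index $H\in(0,1/2)$ on a probability space $(\Omega,\mathcal F,\mathbb P)$, i.e. a centered Gaussian process with covariance $\mathbb E[B^H(t)B^H(s)]=\frac12(t^{2H}+s^{2H}-|t-s|^{2H})$ and continuous paths starting at $0$. $Y_0,k,a,\sigma>0$ are constants. For $\varepsilon>0$, $Y_\varepsilon=\{Y_\varepsilon(t),t\ge0\}$ is the unique (pathwise, continuous) solution of $$Y_\varepsilon(t)=Y_0+\frac12\int_0^t\Big(\frac{k}{Y_\varepsilon(s)\mathbf 1_{\{Y_\varepsilon(s)>0\}}+\varepsilon}-aY_\varepsilon(s)\Big)ds+\frac{\sigma}{2}B^H(t),\quad t\ge0.$$ $Y_\varepsilon(t)$ increases as $\varepsilon$ decreases, and $Y(t)=\lim_{\varepsilon\downarrow0}Y_\varepsilon(t)$, $t\ge0$, is the pointwise limit. Only finite and locally Lebesgue integrable paths of $Y$ are considered (this excludes only a null set). The fractional Cox–Ingersoll–Ross process is $X(t)=Y^2(t)$, $t\ge0$. Almost surely $Y\ge0$, $Y>0$ a.e., and the set $\{t>0\mid Y(t)>0\}$ is open in $\mathbb R$; hence the positivity set is a.s. represented as $$\{t\ge0\mid Y(t)>0\}=[\alpha_0,\beta_0)\cup\Big(\bigcup_{i=1}^N(\alpha_i,\beta_i)\Big),\qquad N\in\mathbb N\cup\{\infty\},$$ where $\alpha_0=0$, $\beta_0$ is the first moment at which $Y$ hits zero, and the (random, pathwise defined) intervals $(\alpha_i,\beta_i)$,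 $i\ge1$, are pairwise disjoint and disjoint from $[\alpha_0,\beta_0)$ (they are the connected components of the positivity set). The endpoints are treated as real (finite) numbers. Pathwise Stratonovich integral: for random processes $U,V$ and $u\le v$, $\int_u^vU_s\circ dV_s$ is the pathwise limit of the sums $\sum_{j=1}^n\frac{U_{t_j}+U_{t_{j-1}}}{2}(V_{t_j}-V_{t_{j-1}})$ as the mesh of the partition $u=t_0<t_1<\dots<t_n=v$ tends to zero, if this limit exists. *)

theory Defs
  imports "HOL-Probability.Probability"
begin

text \<open>A Gaussian real random variable may be degenerate (variance zero), as happens for
  fractional Brownian motion at time 0.\<close>

definition gaussian_rv :: "'a measure \<Rightarrow> ('a \<Rightarrow> real) \<Rightarrow> bool" where
  "gaussian_rv M Z \<longleftrightarrow> Z \<in> borel_measurable M \<and>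
     (\<exists>\<mu>. distr M borel Z = return borel \<mu> \<or>
       (\<exists>s>0. distr M borel Z = density lborel (\<lambda>x. ennreal (normal_density \<mu> s x))))"

text \<open>The index set is the half-line of nonnegative times; the values of a process at negative
  times are never used.\<close>

definition gaussian_process :: "'a measure \<Rightarrow> (real \<Rightarrow> 'a \<Rightarrow> real) \<Rightarrow> bool" where
  "gaussian_process M Z \<longleftrightarrow>
     (\<forall>J c. finite J \<and> J \<subseteq> {0..} \<longrightarrow> gaussian_rv M (\<lambda>\<omega>. \<Sum>t\<in>J. c t * Z t \<omega>))"

definition fractional_brownian_motion :: "'a measure \<Rightarrow> real \<Rightarrow> (real \<Rightarrow> 'a \<Rightarrow> real) \<Rightarrow> bool" where
  "fractional_brownian_motion M H B \<longleftrightarrow>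
     prob_space M \<and> gaussian_process M B \<and>
     (\<forall>t\<ge>0. integral\<^sup>L M (B t) = 0) \<and>
     (\<forall>t\<ge>0. \<forall>s\<ge>0. integral\<^sup>L M (\<lambda>\<omega>. B t \<omega> * B s \<omega>) =
        (t powr (2 * H) + s powr (2 * H) - \<bar>t - s\<bar> powr (2 * H)) / 2) \<and>
     (\<forall>\<omega>\<in>space M. B 0 \<omega> = 0 \<and> continuous_on {0..} (\<lambda>t. B t \<omega>))"

text \<open>The path \<open>y\<close> is a continuous solution of the \<open>\<epsilon>\<close>-regularised equation driven by
  the path \<open>b\<close>. For continuous \<open>y\<close> and positive \<open>k\<close>, \<open>\<epsilon>\<close> the integrand is continuous.\<close>

definition regularized_solution ::
  "real \<Rightarrow> real \<Rightarrow> real \<Rightarrow> real \<Rightarrow> real \<Rightarrow> (real \<Rightarrow> real) \<Rightarrow> (real \<Rightarrow> real) \<Rightarrow> bool" where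
  "regularized_solution Y0 k a \<sigma> \<epsilon> b y \<longleftrightarrow>
     continuous_on {0..} y \<and>
     (\<forall>t\<ge>0. y t = Y0
        + 1/2 * (LINT s:{0..t}|lborel. k / (y s * indicator {0<..} (y s) + \<epsilon>) - a * y s)
        + \<sigma>/2 * b t)"

text \<open>\<open>(\<alpha>, \<beta>)\<close>, with finite endpoints, is one of the open intervals of the representation of
  the positivity set of the path \<open>y\<close>. If \<open>y 0 > 0\<close>, the component containing 0 has the form
  \<open>[0, \<beta>\<^sub>0)\<close> and hence is never an open interval of reals, so that it is excluded automatically.
  Components are nonempty, so that \<open>\<alpha> < \<beta>\<close>.\<close>

definition positivity_set :: "(real \<Rightarrow> real) \<Rightarrow> real set" where
  "positivity_set y = {t. t \<ge> 0 \<and> y t > 0}"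

definition excursion_interval :: "(real \<Rightarrow> real) \<Rightarrow> real \<Rightarrow> real \<Rightarrow> bool" where
  "excursion_interval y \<alpha> \<beta> \<longleftrightarrow> {\<alpha><..<\<beta>} \<in> components (positivity_set y)"

text \<open>\<open>p 0 < \<dots> < p n\<close> is a partition of \<open>[u, v]\<close>; for \<open>u = v\<close> this forces \<open>n = 0\<close>.\<close>

definition interval_partition :: "real \<Rightarrow> real \<Rightarrow> nat \<Rightarrow> (nat \<Rightarrow> real) \<Rightarrow> bool" where
  "interval_partition u v n p \<longleftrightarrow> p 0 = u \<and> p n = v \<and> (\<forall>j\<in>{1..n}. p (j - 1) < p j)"

definition has_stratonovich_integral ::
  "(real \<Rightarrow> real) \<Rightarrow> (real \<Rightarrow> real) \<Rightarrow> real \<Rightarrow> real \<Rightarrow> real \<Rightarrow> bool" where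
  "has_stratonovich_integral U V u v I \<longleftrightarrow>
     (\<forall>e>0. \<exists>\<delta>>0. \<forall>n p. interval_partition u v n p \<and> (\<forall>j\<in>{1..n}. p j - p (j - 1) < \<delta>) \<longrightarrow>
        \<bar>(\<Sum>j=1..n. (U (p j) + U (p (j - 1))) / 2 * (V (p j) - V (p (j - 1)))) - I\<bar> < e)"

end

theory Submission
  imports Defs
begin

text \<open>The argument is pathwise. On a compact subset of the positivity set the increasing
  approximations are bounded away from \<open>0\<close> uniformly, so that dominated convergence yields
  \<open>dY = (k/Y - a Y)/2 dt + \<sigma>/2 dB\<close> in the interior of an excursion. The limit \<open>Y\<close> has no jump at
  the endpoints: at \<open>\<beta>\<close> because the repulsion \<open>k/Y\<close> is nonnegative and so rules out a downward
  jump, at \<open>\<alpha>\<close> because away from \<open>0\<close> the repulsion is bounded, so the approximations cannot climb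
  arbitrarily fast. Hence the equation extends to \<open>[\<alpha>, \<beta>]\<close>. Solving it for \<open>dB\<close>, the Stratonovich
  sums of \<open>Y\<close> against \<open>B\<close> split into telescoping differences of \<open>Y\<^sup>2\<close> and Riemann-Stieltjes sums
  for \<open>Y (k/Y - a Y) = k - a Y\<^sup>2\<close>.\<close>

section \<open>Integrals over compact intervals and last zeros of continuous functions\<close>

lemma set_integrable_Icc_subset:
  fixes f :: "real \<Rightarrow> real"
  assumes "set_integrable lborel {u..v} f" "u \<le> u'" "v' \<le> v"
  shows "set_integrable lborel {u'..v'} f"
  by (rule set_integrable_subset[OF assms(1)]) (use assms in auto)

lemma set_lborel_integral_combine:
  fixes f :: "real \<Rightarrow> real"
  assumes "set_integrable lborel {u..w} f" "u \<le> v" "v \<le> w"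
  shows "(LINT s:{u..w}|lborel. f s) = (LINT s:{u..v}|lborel. f s) + (LINT s:{v..w}|lborel. f s)"
proof -
  have *: "set_integrable lborel {u..v} f" "set_integrable lborel {v..w} f"
    using assms by (auto intro: set_integrable_Icc_subset)
  show ?thesis
    using Henstock_Kurzweil_Integration.integral_combine[OF assms(2,3)
        set_borel_integral_eq_integral(1)[OF assms(1)]]
    by (simp add: set_borel_integral_eq_integral(2)[OF assms(1)]
        set_borel_integral_eq_integral(2)[OF *(1)] set_borel_integral_eq_integral(2)[OF *(2)])
qed

lemma continuous_on_set_lborel_integral:
  fixes f :: "real \<Rightarrow> real"
  assumes "set_integrable lborel {u..v} f"
  shows "continuous_on {u..v} (\<lambda>t. LINT s:{u..t}|lborel. f s)"
proof -
  have "continuous_on {u..v} (\<lambda>t. integral {u..t} f)"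
    by (rule indefinite_integral_continuous_1[OF set_borel_integral_eq_integral(1)[OF assms]])
  moreover have "(LINT s:{u..t}|lborel. f s) = integral {u..t} f" if "t \<in> {u..v}" for t
    using set_integrable_Icc_subset[OF assms, of u t] that
    by (intro set_borel_integral_eq_integral(2)) auto
  ultimately show ?thesis
    by (subst continuous_on_cong[OF refl]) auto
qed

lemma set_lborel_integral_const:
  assumes "u \<le> v"
  shows "(LINT s:{u..v}|lborel. c) = (v - u) * (c::real)"
  using assms by (subst set_integral_const) auto

text \<open>Comparison device for integral equations: after the last zero the sign of
  \<open>f\<close> is fixed, so the drifts can be compared on the whole of \<open>{s..t}\<close>. It
  is applied to a difference of two approximations and to one approximation relative to a level. The
  last zero is the greatest element of the compact set where \<open>f\<close> is
  nonnegative.\<close>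

lemma last_crossing:
  fixes f :: "real \<Rightarrow> real"
  assumes cont: "continuous_on {u..t} f" and "u \<le> t" "0 \<le> f u" "f t < 0"
  obtains s where "u \<le> s" "s < t" "f s = 0" "\<And>r. s < r \<Longrightarrow> r \<le> t \<Longrightarrow> f r < 0"
proof -
  define S where "S = {u..t} \<inter> f -` {0..}"
  have "compact S"
    unfolding compact_eq_bounded_closed S_def
    using continuous_closed_preimage[OF cont, of "{0..}"] by (auto intro: bounded_subset[of "{u..t}"])
  moreover have "S \<noteq> {}"
    using assms by (auto simp: S_def)
  ultimately obtain s where s: "s \<in> S" "\<And>r. r \<in> S \<Longrightarrow> r \<le> s"
    by (meson compact_attains_sup)
  have neg: "f r < 0" if "s < r" "r \<le> t" for r
    using s(1) s(2)[of r] that by (cases "f r < 0") (auto simp: S_def)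
  have "s < t"
    using s(1) assms(4) by (cases "s = t") (auto simp: S_def)
  \<comment> \<open>The intermediate value theorem yields a zero in \<open>{s..t}\<close>; as
    \<open>f\<close> is negative after \<open>s\<close>, it can only be \<open>s\<close>
    itself.\<close>
  have "\<exists>r. s \<le> r \<and> r \<le> t \<and> f r = 0"
    using s(1) assms by (intro IVT2' continuous_on_subset[OF cont]) (auto simp: S_def)
  then have "f s = 0"
    using neg by (metis less_irrefl order_le_imp_less_or_eq)
  with s(1) neg \<open>s < t\<close> show ?thesis
    by (intro that) (auto simp: S_def)
qed

section \<open>Partitions and Stratonovich sums\<close>

lemma interval_partition_mono:
  assumes "interval_partition u v n p" "i \<le> j" "j \<le> n"
  shows "p i \<le> p j"
  using assms(2,3)
proof (induction j rule: dec_induct)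
  case (step m)
  then have "p m < p (Suc m)"
    using assms(1) unfolding interval_partition_def by (auto dest!: bspec[of _ _ "Suc m"])
  with step show ?case by simp
qed simp

lemma interval_partition_bounds:
  assumes "interval_partition u v n p" "j \<le> n"
  shows "u \<le> p j" "p j \<le> v"
  using interval_partition_mono[OF assms(1), of 0 j] interval_partition_mono[OF assms(1), of j n] assms
  by (auto simp: interval_partition_def)

text \<open>All partition points lie in the interval, so only values of the integrand there enter
  the sums. This later replaces the path of \<open>Y\<close> by the square root of \<open>X\<close>,
  for which agreement is known only from the left endpoint on.\<close>

lemma has_stratonovich_integral_cong:
  assumes "has_stratonovich_integral U V u v I" and eq: "\<And>s. u \<le> s \<Longrightarrow> s \<le> v \<Longrightarrow> U' s = U s"
  shows "has_stratonovich_integral U' V u v I"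
proof -
  have sum_eq: "(\<Sum>j=1..n. (U' (p j) + U' (p (j - 1))) / 2 * (V (p j) - V (p (j - 1))))
      = (\<Sum>j=1..n. (U (p j) + U (p (j - 1))) / 2 * (V (p j) - V (p (j - 1))))"
    if "interval_partition u v n p" for n p
    by (intro sum.cong refl) (auto simp: eq interval_partition_bounds[OF that])
  show ?thesis
    unfolding has_stratonovich_integral_def
  proof (intro allI impI)
    fix e :: real assume "0 < e"
    then obtain d where "0 < d" and d: "\<And>n p. interval_partition u v n p \<Longrightarrow>
        (\<forall>j\<in>{1..n}. p j - p (j - 1) < d) \<Longrightarrow>
        \<bar>(\<Sum>j=1..n. (U (p j) + U (p (j - 1))) / 2 * (V (p j) - V (p (j - 1)))) - I\<bar> < e"
      using assms(1) unfolding has_stratonovich_integral_def by blast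
    show "\<exists>\<delta>>0. \<forall>n p. interval_partition u v n p \<and> (\<forall>j\<in>{1..n}. p j - p (j - 1) < \<delta>) \<longrightarrow>
        \<bar>(\<Sum>j=1..n. (U' (p j) + U' (p (j - 1))) / 2 * (V (p j) - V (p (j - 1)))) - I\<bar> < e"
    proof (intro exI[of _ d] conjI allI impI \<open>0 < d\<close>)
      fix n p assume part: "interval_partition u v n p \<and> (\<forall>j\<in>{1..n}. p j - p (j - 1) < d)"
      show "\<bar>(\<Sum>j=1..n. (U' (p j) + U' (p (j - 1))) / 2 * (V (p j) - V (p (j - 1)))) - I\<bar> < e"
        unfolding sum_eq[OF part[THEN conjunct1]] using part by (intro d) auto
    qed
  qed
qed

text \<open>Substituting the increments of \<open>b\<close>, the \<open>c\<close>-part of the sums telescopes, and in the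
  \<open>g\<close>-part \<open>y\<close> may be frozen on each subinterval because it is uniformly continuous.\<close>

lemma has_stratonovich_integral_of_increments:
  fixes y b g :: "real \<Rightarrow> real"
  assumes cont: "continuous_on {u..v} y" and "u \<le> v" and int: "set_integrable lborel {u..v} g"
    and inc: "\<And>s t. u \<le> s \<Longrightarrow> s \<le> t \<Longrightarrow> t \<le> v \<Longrightarrow>
      b t - b s = c * (y t - y s) - (LINT r:{s..t}|lborel. g r)"
  shows "set_integrable lborel {u..v} (\<lambda>r. y r * g r)"
    and "has_stratonovich_integral y b u v
      (c * ((y v)\<^sup>2 - (y u)\<^sup>2) / 2 - (LINT r:{u..v}|lborel. y r * g r))"
proof -
  obtain K where K: "\<And>r. r \<in> {u..v} \<Longrightarrow> \<bar>y r\<bar> \<le> K"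
  proof -
    have "bounded (y ` {u..v})"
      using cont by (intro compact_imp_bounded compact_continuous_image) auto
    then obtain K where "\<forall>x\<in>{u..v}. \<bar>y x\<bar> \<le> K"
      by (auto simp: bounded_iff)
    then show ?thesis
      by (intro that) auto
  qed
  have meas: "set_borel_measurable lborel {u..v} (\<lambda>r. y r * g r)"
  proof -
    have "set_borel_measurable lborel {u..v} y"
      using borel_integrable_atLeastAtMost'[OF cont]
      by (auto simp: set_integrable_def set_borel_measurable_def)
    moreover have "set_borel_measurable lborel {u..v} g"
      using int by (auto simp: set_integrable_def set_borel_measurable_def)
    \<comment> \<open>The square of an indicator is the indicator, so this product of the two
      restricted functions is the restriction of \<open>y r * g r\<close>.\<close>
    ultimately have "(\<lambda>r. (indicator {u..v} r *\<^sub>R y r) * (indicator {u..v} r *\<^sub>R g r)) \<in> borel_measurable lborel"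
      unfolding set_borel_measurable_def by (rule borel_measurable_times)
    then show ?thesis
      unfolding set_borel_measurable_def
      by (rule measurable_cong[THEN iffD1, rotated]) (auto split: split_indicator)
  qed
  show yg: "set_integrable lborel {u..v} (\<lambda>r. y r * g r)"
  proof (rule set_integrable_bound[OF _ meas])
    show "set_integrable lborel {u..v} (\<lambda>r. K * g r)"
      using int by simp
    show "AE r in lborel. r \<in> {u..v} \<longrightarrow> norm (y r * g r) \<le> norm (K * g r)"
      using K by (intro AE_I2) (fastforce simp: abs_mult intro!: mult_right_mono)
  qed
  define G where "G = (LINT r:{u..v}|lborel. \<bar>g r\<bar>)"
  have absint: "set_integrable lborel {u..v} (\<lambda>r. \<bar>g r\<bar>)"
    by (rule set_integrable_abs[OF int])
  have "G \<ge> 0"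
    unfolding G_def set_lebesgue_integral_def by (intro integral_nonneg_AE) auto
  show "has_stratonovich_integral y b u v
      (c * ((y v)\<^sup>2 - (y u)\<^sup>2) / 2 - (LINT r:{u..v}|lborel. y r * g r))"
    unfolding has_stratonovich_integral_def
  proof (intro allI impI)
    fix e :: real assume "e > 0"
    \<comment> \<open>The total error will be at most \<open>\<eta> * G\<close>; the summand 1 keeps
      the quotient defined for \<open>G = 0\<close> and makes the final inequality strict.\<close>
    define \<eta> where "\<eta> = e / (G + 1)"
    have "\<eta> > 0" using \<open>e > 0\<close> \<open>G \<ge> 0\<close> by (simp add: \<eta>_def)
    have "uniformly_continuous_on {u..v} y"
      using cont by (intro compact_uniformly_continuous) auto
    then obtain d where "d > 0"
      and d: "\<And>s t. s \<in> {u..v} \<Longrightarrow> t \<in> {u..v} \<Longrightarrow> \<bar>t - s\<bar> < d \<Longrightarrow> \<bar>y t - y s\<bar> < \<eta>"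
      using \<open>\<eta> > 0\<close> unfolding uniformly_continuous_on_def dist_real_def by metis
    have "\<bar>(\<Sum>j=1..n. (y (p j) + y (p (j - 1))) / 2 * (b (p j) - b (p (j - 1)))) -
         (c * ((y v)\<^sup>2 - (y u)\<^sup>2) / 2 - (LINT r:{u..v}|lborel. y r * g r))\<bar> < e"
      if part: "interval_partition u v n p" and mesh: "\<forall>j\<in>{1..n}. p j - p (j - 1) < d" for n p
    proof -
      have p0: "p 0 = u" and pn: "p n = v"
        using part by (auto simp: interval_partition_def)
      note mono = interval_partition_mono[OF part] and pin = interval_partition_bounds[OF part]
      \<comment> \<open>Induction over an initial segment of the partition: each subinterval adds at
        most \<open>\<eta>\<close> times the integral of the absolute value of \<open>g\<close> over
        it, and these bounds add up.\<close>
      have main: "\<bar>(\<Sum>j<m. (y (p (Suc j)) + y (p j)) / 2 * (b (p (Suc j)) - b (p j))) -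
         (c * ((y (p m))\<^sup>2 - (y u)\<^sup>2) / 2 - (LINT r:{u..p m}|lborel. y r * g r))\<bar>
         \<le> \<eta> * (LINT r:{u..p m}|lborel. \<bar>g r\<bar>)" if "m \<le> n" for m
        using that
      proof (induction m)
        case 0
        have "(LINT r:{u..u}|lborel. f r) = 0" for f :: "real \<Rightarrow> real"
          using set_borel_integral_eq_integral(2)[of "{u..u}" f] by simp
        then show ?case by (simp add: p0)
      next
        case (Suc m)
        let ?s = "p m" and ?t = "p (Suc m)"
        let ?a = "(y ?t + y ?s) / 2"
        have st: "u \<le> ?s" "?s \<le> ?t" "?t \<le> v"
          using Suc.prems pin[of m] pin[of "Suc m"] mono[of m "Suc m"] by auto
        have sub: "set_integrable lborel {?s..?t} f" if "set_integrable lborel {u..v} f" for f :: "real \<Rightarrow> real"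
          using that st by (auto intro: set_integrable_Icc_subset)
        have comb: "(LINT r:{u..?t}|lborel. f r) = (LINT r:{u..?s}|lborel. f r) + (LINT r:{?s..?t}|lborel. f r)"
          if "set_integrable lborel {u..v} f" for f :: "real \<Rightarrow> real"
          using st set_integrable_Icc_subset[OF that, of u ?t] by (intro set_lborel_integral_combine) auto
        have close: "\<bar>y r - ?a\<bar> \<le> \<eta>" if "r \<in> {?s..?t}" for r
        proof -
          have "?t - ?s < d" using mesh Suc.prems by (auto dest!: bspec[of _ _ "Suc m"])
          then have "\<bar>y r - y ?s\<bar> < \<eta>" "\<bar>y r - y ?t\<bar> < \<eta>"
            using that st by (auto intro!: d)
          then show ?thesis by (simp add: abs_if field_simps split: if_splits)
        qed
        have "(LINT r:{?s..?t}|lborel. y r * g r) - ?a * (LINT r:{?s..?t}|lborel. g r)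
            = (LINT r:{?s..?t}|lborel. (y r - ?a) * g r)"
          using sub[OF int] sub[OF yg] by (simp add: left_diff_distrib)
        also have "\<bar>\<dots>\<bar> \<le> (LINT r:{?s..?t}|lborel. norm ((y r - ?a) * g r))"
          using sub[OF int] sub[OF yg]
            set_integral_norm_bound[of lborel "{?s..?t}" "\<lambda>r. (y r - ?a) * g r"]
          by (simp add: left_diff_distrib)
        also have "\<dots> \<le> (LINT r:{?s..?t}|lborel. \<eta> * \<bar>g r\<bar>)"
        proof (rule set_integral_mono)
          show "set_integrable lborel {?s..?t} (\<lambda>r. norm ((y r - ?a) * g r))"
            using sub[OF int] sub[OF yg] unfolding real_norm_def
            by (intro set_integrable_abs) (simp add: left_diff_distrib)
          show "set_integrable lborel {?s..?t} (\<lambda>r. \<eta> * \<bar>g r\<bar>)"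
            using sub[OF absint] by simp
          show "norm ((y r - ?a) * g r) \<le> \<eta> * \<bar>g r\<bar>" if "r \<in> {?s..?t}" for r
            using close[OF that] by (simp add: abs_mult mult_right_mono)
        qed
        also have "\<dots> = \<eta> * (LINT r:{?s..?t}|lborel. \<bar>g r\<bar>)"
          by simp
        finally have loc: "\<bar>(LINT r:{?s..?t}|lborel. y r * g r) - ?a * (LINT r:{?s..?t}|lborel. g r)\<bar>
            \<le> \<eta> * (LINT r:{?s..?t}|lborel. \<bar>g r\<bar>)" .
        \<comment> \<open>The average of the two endpoint values times the increment of
          \<open>y\<close> is exactly half the difference of squares, so the symmetric sums leave no
          second-order remainder.\<close>
        have "?a * (b ?t - b ?s) = c * ((y ?t)\<^sup>2 - (y ?s)\<^sup>2) / 2 - ?a * (LINT r:{?s..?t}|lborel. g r)"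
          unfolding inc[OF st] by (simp add: field_simps power2_eq_square)
        then show ?case
          using Suc.IH Suc.prems loc
          unfolding comb[OF yg] comb[OF absint] sum.lessThan_Suc
          by (simp add: algebra_simps add_divide_distrib diff_divide_distrib)
      qed
      have "(\<Sum>j=1..n. (y (p j) + y (p (j - 1))) / 2 * (b (p j) - b (p (j - 1))))
          = (\<Sum>j<n. (y (p (Suc j)) + y (p j)) / 2 * (b (p (Suc j)) - b (p j)))"
        by (rule sum.reindex_bij_witness[of _ Suc "\<lambda>j. j - 1"]) auto
      moreover have "\<eta> * G < e"
        using \<open>e > 0\<close> \<open>G \<ge> 0\<close> by (simp add: \<eta>_def field_simps)
      ultimately show ?thesis
        using main[of n] by (simp add: pn G_def)
    qed
    then show "\<exists>\<delta>>0. \<forall>n p. interval_partition u v n p \<and> (\<forall>j\<in>{1..n}. p j - p (j - 1) < \<delta>) \<longrightarrow>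
        \<bar>(\<Sum>j=1..n. (y (p j) + y (p (j - 1))) / 2 * (b (p j) - b (p (j - 1)))) -
         (c * ((y v)\<^sup>2 - (y u)\<^sup>2) / 2 - (LINT r:{u..v}|lborel. y r * g r))\<bar> < e"
      using \<open>d > 0\<close> by blast
  qed
qed

section \<open>The approximations along a sequence: increments and monotonicity\<close>

locale regularized_limit =
  fixes Y0 k a \<sigma> :: real and e :: "nat \<Rightarrow> real" and b y :: "real \<Rightarrow> real"
    and z :: "nat \<Rightarrow> real \<Rightarrow> real"
  assumes Y0: "0 < Y0" and k: "0 < k" and a: "0 < a" and \<sigma>: "0 < \<sigma>"
    and e_pos: "\<And>n. 0 < e n" and e_dec: "decseq e" and e_lim: "e \<longlonglongrightarrow> 0"
    and b0: "b 0 = 0" and b_cont: "continuous_on {0..} b"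
    and sol: "\<And>n. regularized_solution Y0 k a \<sigma> (e n) b (z n)"
    and lim: "\<And>t. 0 \<le> t \<Longrightarrow> (\<lambda>n. z n t) \<longlonglongrightarrow> y t"
    and y_int: "\<And>T. 0 \<le> T \<Longrightarrow> set_integrable lborel {0..T} y"
begin

text \<open>The factor with the indicator in the regularised equation is the positive part of
  \<open>z n s\<close>. Written with \<open>max\<close>, the term is visibly continuous, with
  denominator at least \<open>e n\<close>.\<close>

definition repulsion :: "nat \<Rightarrow> real \<Rightarrow> real" where
  "repulsion n s = k / (max 0 (z n s) + e n)"

lemma z_cont: "continuous_on {0..} (z n)"
  using sol[of n] by (simp add: regularized_solution_def)

lemma repulsion_cont: "continuous_on {0..} (repulsion n)"
  unfolding repulsion_def
  by (intro continuous_intros z_cont) (use e_pos[of n] in \<open>auto simp: max_def\<close>)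

lemma repulsion_nonneg: "0 \<le> repulsion n s"
  using k e_pos[of n] by (simp add: repulsion_def)

lemma
  assumes "0 \<le> u"
  shows z_integrable: "set_integrable lborel {u..v} (z n)"
    and repulsion_integrable: "set_integrable lborel {u..v} (repulsion n)"
  using assms
  by (auto intro!: borel_integrable_atLeastAtMost' continuous_on_subset[OF z_cont]
      continuous_on_subset[OF repulsion_cont])

lemma y_integrable: "0 \<le> u \<Longrightarrow> set_integrable lborel {u..v} y"
  using set_integrable_Icc_subset[OF y_int[of "max 0 v"], of u v] by simp

lemma z_eq:
  assumes "0 \<le> t"
  shows "z n t = Y0
    + 1/2 * ((LINT s:{0..t}|lborel. repulsion n s) - a * (LINT s:{0..t}|lborel. z n s)) + \<sigma>/2 * b t"
proof -
  have *: "x * indicator {0<..} x = max 0 x" for x :: real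
    by (auto split: split_indicator)
  have "z n t = Y0 + 1/2 * (LINT s:{0..t}|lborel. repulsion n s - a * z n s) + \<sigma>/2 * b t"
    using sol[of n] assms by (simp add: regularized_solution_def repulsion_def *)
  then show ?thesis
    using z_integrable[of 0 t n] repulsion_integrable[of 0 t n] by simp
qed

lemma z_0: "z n 0 = Y0"
  using set_borel_integral_eq_integral(2)[OF z_integrable, of 0 0 n]
    set_borel_integral_eq_integral(2)[OF repulsion_integrable, of 0 0 n]
  by (simp add: z_eq[of 0 n] b0)

lemma z_increment:
  assumes "0 \<le> u" "u \<le> v"
  shows "z n v - z n u =
    1/2 * ((LINT s:{u..v}|lborel. repulsion n s) - a * (LINT s:{u..v}|lborel. z n s)) + \<sigma>/2 * (b v - b u)"
proof -
  have "(LINT s:{0..v}|lborel. z n s) = (LINT s:{0..u}|lborel. z n s) + (LINT s:{u..v}|lborel. z n s)"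
    "(LINT s:{0..v}|lborel. repulsion n s)
      = (LINT s:{0..u}|lborel. repulsion n s) + (LINT s:{u..v}|lborel. repulsion n s)"
    using assms by (auto intro!: set_lborel_integral_combine z_integrable repulsion_integrable)
  then show ?thesis
    using assms by (simp add: z_eq[of u n] z_eq[of v n] field_simps)
qed

text \<open>Suppose the order fails at \<open>t\<close>. After the last zero of the difference,
  \<open>z m\<close> lies below \<open>z n\<close>; with the smaller \<open>e m\<close> it is
  repelled at least as strongly and damped at most as much, and the noise is the same. So the
  difference cannot have decreased from 0 to a negative value.\<close>

lemma z_mono:
  assumes "n \<le> m" "0 \<le> t"
  shows "z n t \<le> z m t"
proof (rule ccontr)
  assume "\<not> z n t \<le> z m t"
  then have neg: "z m t - z n t < 0" by simp
  have "continuous_on {0..t} (\<lambda>s. z m s - z n s)"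
    by (intro continuous_intros continuous_on_subset[OF z_cont]) auto
  then obtain s where s: "0 \<le> s" "s < t" "z m s - z n s = 0"
    and below: "\<And>r. s < r \<Longrightarrow> r \<le> t \<Longrightarrow> z m r - z n r < 0"
    by (rule last_crossing[where f = "\<lambda>s. z m s - z n s"]) (use assms neg in \<open>auto simp: z_0\<close>)
  have le: "z m r \<le> z n r" if "r \<in> {s..t}" for r
    using that s(3) below[of r] by (cases "r = s") auto
  have "e m \<le> e n"
    using e_dec \<open>n \<le> m\<close> by (simp add: decseq_def)
  then have "repulsion n r \<le> repulsion m r" if "r \<in> {s..t}" for r
    unfolding repulsion_def using le[OF that] k e_pos[of m] e_pos[of n]
    by (intro divide_left_mono add_mono mult_pos_pos max.mono) (auto simp: add_nonneg_pos)
  then have "(LINT r:{s..t}|lborel. repulsion n r) \<le> (LINT r:{s..t}|lborel. repulsion m r)"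
    using s by (intro set_integral_mono repulsion_integrable) auto
  moreover have "a * (LINT r:{s..t}|lborel. z m r) \<le> a * (LINT r:{s..t}|lborel. z n r)"
    using s a le by (intro mult_left_mono set_integral_mono z_integrable) auto
  ultimately show False
    using z_increment[of s t n] z_increment[of s t m] s neg by argo
qed

section \<open>The limit path: nonnegativity and passage to the limit in the integrated
  equation\<close>

lemma z_le_y: "0 \<le> t \<Longrightarrow> z n t \<le> y t"
  by (rule incseq_le[OF _ lim]) (auto simp: incseq_def z_mono)

lemma b_bound:
  obtains C where "\<And>s. 0 \<le> s \<Longrightarrow> s \<le> t \<Longrightarrow> \<bar>b s\<bar> \<le> C"
proof -
  have "bounded (b ` {0..t})"
    by (intro compact_imp_bounded compact_continuous_image continuous_on_subset[OF b_cont]) auto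
  then obtain C where "\<forall>s\<in>{0..t}. \<bar>b s\<bar> \<le> C"
    by (auto simp: bounded_iff)
  then show ?thesis
    by (intro that[of C]) auto
qed

text \<open>While \<open>z n\<close> is negative it is pushed up at rate at least \<open>k / (2 * e n)\<close>, so it can be
  negative at \<open>t\<close> only if its last zero before \<open>t\<close> is at distance \<open>O(e n)\<close>.\<close>

lemma y_nonneg:
  assumes "0 \<le> t"
  shows "0 \<le> y t"
proof (rule ccontr)
  assume "\<not> 0 \<le> y t"
  then have neg: "z n t < 0" for n
    using z_le_y[OF assms, of n] by simp
  obtain C where C: "\<And>s. 0 \<le> s \<Longrightarrow> s \<le> t \<Longrightarrow> \<bar>b s\<bar> \<le> C"
    using b_bound by metis
  have "\<exists>s. 0 \<le> s \<and> s \<le> t \<and> t - s \<le> 2 * \<sigma> * C / k * e n \<and> \<sigma>/2 * (b t - b s) \<le> z n t" for n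
  proof -
    have "continuous_on {0..t} (z n)"
      by (rule continuous_on_subset[OF z_cont]) auto
    then obtain s where s: "0 \<le> s" "s < t" "z n s = 0"
      and below: "\<And>r. s < r \<Longrightarrow> r \<le> t \<Longrightarrow> z n r < 0"
      by (rule last_crossing) (use assms neg Y0 in \<open>auto simp: z_0\<close>)
    have le: "z n r \<le> 0" if "r \<in> {s..t}" for r
      using that s(3) below[of r] by (cases "r = s") auto
    have "(LINT r:{s..t}|lborel. k / e n) \<le> (LINT r:{s..t}|lborel. repulsion n r)"
      using s le by (intro set_integral_mono repulsion_integrable borel_integrable_atLeastAtMost')
        (auto simp: repulsion_def)
    then have 1: "(t - s) * (k / e n) \<le> (LINT r:{s..t}|lborel. repulsion n r)"
      using s by (simp add: set_lborel_integral_const)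
    have "(LINT r:{s..t}|lborel. z n r) \<le> (LINT r:{s..t}|lborel. 0)"
      using s le by (intro set_integral_mono z_integrable borel_integrable_atLeastAtMost') auto
    then have "a * (LINT r:{s..t}|lborel. z n r) \<le> 0"
      using a by (simp add: mult_nonneg_nonpos)
    with 1 have 2: "1/2 * ((t - s) * (k / e n)) + \<sigma>/2 * (b t - b s) \<le> z n t"
      using z_increment[of s t n] s by simp
    have 3: "0 \<le> (t - s) * (k / e n)"
      using s k e_pos[of n] by simp
    \<comment> \<open>Since \<open>z n t\<close> is negative, the gain from repulsion is smaller
      than the loss through the noise, and the increment of \<open>b\<close> is at most
      \<open>2 * C\<close> in absolute value.\<close>
    have "\<sigma> * (b s - b t) \<le> \<sigma> * (2 * C)"
      using C[of s] C[of t] s \<sigma> by (intro mult_left_mono) (auto simp: abs_le_iff)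
    then have "(t - s) * (k / e n) \<le> 2 * \<sigma> * C"
      using 2 neg[of n] by argo
    then have "t - s \<le> 2 * \<sigma> * C / k * e n"
      using k e_pos[of n] by (simp add: field_simps)
    moreover have "\<sigma>/2 * (b t - b s) \<le> z n t"
      using 2 3 by argo
    ultimately show ?thesis
      using s by (intro exI[of _ s]) auto
  qed
  then obtain s where s: "\<And>n. 0 \<le> s n" "\<And>n. s n \<le> t" "\<And>n. t - s n \<le> 2 * \<sigma> * C / k * e n"
    and below: "\<And>n. \<sigma>/2 * (b t - b (s n)) \<le> z n t"
    by metis
  \<comment> \<open>The last zeros converge to \<open>t\<close>, so by continuity of
    \<open>b\<close> the lower bound for \<open>z n t\<close> tends to 0, contradicting a negative
    limit.\<close>
  have "(\<lambda>n. t - s n) \<longlonglongrightarrow> 0"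
  proof (rule tendsto_sandwich[OF _ _ tendsto_const])
    show "(\<lambda>n. 2 * \<sigma> * C / k * e n) \<longlonglongrightarrow> 0"
      using tendsto_mult_left[OF e_lim, of "2 * \<sigma> * C / k"] by simp
  qed (use s in auto)
  then have "s \<longlonglongrightarrow> t"
    using tendsto_diff[OF tendsto_const[of t]] by fastforce
  then have "(\<lambda>n. b (s n)) \<longlonglongrightarrow> b t"
    using s assms by (intro continuous_on_tendsto_compose[OF b_cont]) auto
  then have "(\<lambda>n. \<sigma>/2 * (b t - b (s n))) \<longlonglongrightarrow> \<sigma>/2 * (b t - b t)"
    by (intro tendsto_intros)
  then have "\<sigma>/2 * (b t - b t) \<le> y t"
    by (rule LIMSEQ_le[OF _ lim[OF assms]]) (use below in auto)
  with \<open>\<not> 0 \<le> y t\<close> show False by simp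
qed

text \<open>A compactness argument in the manner of Dini, without continuity of \<open>y\<close>.
  Otherwise there are points \<open>s N\<close> with \<open>z N (s N) < e N\<close>, accumulating at
  some \<open>l\<close>. By monotonicity in the index and continuity of each fixed
  \<open>z m\<close>, all \<open>z m l\<close> are at most 0, hence so is \<open>y l\<close>. The
  bound obtained is \<open>e N\<close> for a suitable \<open>N\<close>.\<close>

lemma z_uniformly_positive:
  assumes "0 \<le> u" and pos: "\<And>s. s \<in> {u..v} \<Longrightarrow> 0 < y s"
  obtains N c where "0 < c" "\<And>n s. N \<le> n \<Longrightarrow> s \<in> {u..v} \<Longrightarrow> c \<le> z n s"
proof -
  have "\<exists>N. \<forall>s\<in>{u..v}. e N \<le> z N s"
  proof (rule ccontr)
    assume "\<nexists>N. \<forall>s\<in>{u..v}. e N \<le> z N s"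
    then obtain s where s: "\<And>N. s N \<in> {u..v}" "\<And>N. z N (s N) < e N"
      by (metis not_le)
    obtain l r where l: "l \<in> {u..v}" and r: "strict_mono r" "(s \<circ> r) \<longlonglongrightarrow> l"
      using compact_Icc[of u v] s(1) unfolding compact_def by metis
    have "z m l \<le> 0" for m
    proof (rule LIMSEQ_le)
      have "0 \<le> s (r j)" for j
        using s(1)[of "r j"] assms(1) by simp
      then show "(\<lambda>j. z m ((s \<circ> r) j)) \<longlonglongrightarrow> z m l"
        using l assms(1) by (intro continuous_on_tendsto_compose[OF z_cont r(2)]) auto
      show "(e \<circ> r) \<longlonglongrightarrow> 0"
        using LIMSEQ_subseq_LIMSEQ[OF e_lim r(1)] .
      have "z m (s (r j)) \<le> e (r j)" if "m \<le> j" for j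
      proof -
        have "m \<le> r j" using that seq_suble[OF r(1), of j] by simp
        then have "z m (s (r j)) \<le> z (r j) (s (r j))"
          using s(1)[of "r j"] assms(1) by (intro z_mono) auto
        then show ?thesis using s(2)[of "r j"] by simp
      qed
      then show "\<exists>N. \<forall>j\<ge>N. z m ((s \<circ> r) j) \<le> (e \<circ> r) j"
        by auto
    qed
    then have "y l \<le> 0"
      using lim[of l] l assms(1) by (intro LIMSEQ_le_const2) auto
    with pos[OF l] show False by simp
  qed
  then obtain N where N: "\<And>s. s \<in> {u..v} \<Longrightarrow> e N \<le> z N s"
    by blast
  have "e N \<le> z n s" if "N \<le> n" "s \<in> {u..v}" for n s
    using N[OF that(2)] z_mono[OF that(1), of s] that(2) assms(1) by simp
  then show ?thesis
    using that e_pos by blast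
qed

text \<open>The approximations lie between \<open>z 0\<close> and \<open>y\<close>, so local
  integrability of \<open>y\<close> supplies a dominating function, also on intervals where
  \<open>y\<close> has zeros.\<close>

lemma lim_integral_z:
  assumes "0 \<le> u"
  shows "(\<lambda>n. LINT s:{u..v}|lborel. z n s) \<longlonglongrightarrow> (LINT s:{u..v}|lborel. y s)"
  unfolding set_lebesgue_integral_def
proof (rule integral_dominated_convergence)
  show "integrable lborel (\<lambda>s. indicator {u..v} s *\<^sub>R (\<bar>y s\<bar> + \<bar>z 0 s\<bar>))"
    using set_integral_add(1)[OF set_integrable_abs[OF y_integrable[OF assms]]
        set_integrable_abs[OF z_integrable[OF assms]]]
    by (simp add: set_integrable_def)
  show "AE s in lborel. (\<lambda>n. indicat_real {u..v} s *\<^sub>R z n s) \<longlonglongrightarrow> indicat_real {u..v} s *\<^sub>R y s"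
    using assms lim by (intro AE_I2) (auto split: split_indicator)
  show "AE s in lborel. norm (indicat_real {u..v} s *\<^sub>R z n s) \<le> indicat_real {u..v} s *\<^sub>R (\<bar>y s\<bar> + \<bar>z 0 s\<bar>)" for n
  proof (intro AE_I2)
    fix s
    show "norm (indicat_real {u..v} s *\<^sub>R z n s) \<le> indicat_real {u..v} s *\<^sub>R (\<bar>y s\<bar> + \<bar>z 0 s\<bar>)"
      using assms z_le_y[of s n] z_mono[of 0 n s] by (auto split: split_indicator)
  qed
qed (use y_integrable[OF assms] z_integrable[OF assms] in
    \<open>auto simp: set_integrable_def dest: borel_measurable_integrable\<close>)

text \<open>From some index \<open>N\<close> on, the approximations are at least
  \<open>c > 0\<close> on the interval, so the constant \<open>k / c\<close> dominates the
  repulsion; hence the shift by \<open>N\<close> in \<open>?g\<close>.\<close>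

lemma
  assumes "0 \<le> u" and pos: "\<And>s. s \<in> {u..v} \<Longrightarrow> 0 < y s"
  shows inverse_y_integrable: "set_integrable lborel {u..v} (\<lambda>s. k / y s)"
    and lim_integral_repulsion:
      "(\<lambda>n. LINT s:{u..v}|lborel. repulsion n s) \<longlonglongrightarrow> (LINT s:{u..v}|lborel. k / y s)"
proof -
  obtain N c where c: "0 < c" "\<And>n s. N \<le> n \<Longrightarrow> s \<in> {u..v} \<Longrightarrow> c \<le> z n s"
    using z_uniformly_positive[OF assms] by metis
  let ?f = "\<lambda>s. indicat_real {u..v} s *\<^sub>R (k / y s)"
  let ?g = "\<lambda>n s. indicat_real {u..v} s *\<^sub>R repulsion (n + N) s"
  \<comment> \<open>Moving the indicator into the denominator is harmless: outside the interval this
    gives \<open>k / 0 = 0\<close>. Measurability then follows from that of the restricted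
    \<open>y\<close>.\<close>
  have "?f = (\<lambda>s. k / (indicat_real {u..v} s *\<^sub>R y s))"
    by (auto split: split_indicator)
  also have "\<dots> \<in> borel_measurable lborel"
    using y_integrable[OF assms(1)] unfolding set_integrable_def
    by (intro borel_measurable_divide) auto
  finally have f: "?f \<in> borel_measurable lborel" .
  have g: "?g n \<in> borel_measurable lborel" for n
    using repulsion_integrable[OF assms(1)] by (auto simp: set_integrable_def)
  have w: "integrable lborel (\<lambda>s. indicat_real {u..v} s *\<^sub>R (k / c))"
    using borel_integrable_atLeastAtMost'[of u v "\<lambda>_. k / c"] by (simp add: set_integrable_def)
  have g_lim: "AE s in lborel. (\<lambda>n. ?g n s) \<longlonglongrightarrow> ?f s"
  proof (intro AE_I2)
    fix s
    show "(\<lambda>n. ?g n s) \<longlonglongrightarrow> ?f s"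
    proof (cases "s \<in> {u..v}")
      case True
      have "(\<lambda>n. repulsion n s) \<longlonglongrightarrow> k / (max 0 (y s) + 0)"
        unfolding repulsion_def using True pos[OF True] assms(1)
        by (intro tendsto_intros lim e_lim) auto
      then have "(\<lambda>n. repulsion (n + N) s) \<longlonglongrightarrow> k / y s"
        using pos[OF True] by (intro LIMSEQ_ignore_initial_segment) (simp add: max_def)
      then show ?thesis using True by simp
    qed simp
  qed
  have bound: "AE s in lborel. norm (?g n s) \<le> indicat_real {u..v} s *\<^sub>R (k / c)" for n
  proof (intro AE_I2)
    fix s
    have "repulsion (n + N) s \<le> k / c" if "s \<in> {u..v}"
      unfolding repulsion_def using that k c(1) c(2)[of "n + N" s] e_pos[of "n + N"]
      by (intro divide_left_mono) auto
    then show "norm (?g n s) \<le> indicat_real {u..v} s *\<^sub>R (k / c)"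
      using repulsion_nonneg[of "n + N" s] by (auto split: split_indicator)
  qed
  show "set_integrable lborel {u..v} (\<lambda>s. k / y s)"
    unfolding set_integrable_def by (rule integrable_dominated_convergence[OF f g w g_lim bound])
  have "(\<lambda>n. LINT s:{u..v}|lborel. repulsion (n + N) s) \<longlonglongrightarrow> (LINT s:{u..v}|lborel. k / y s)"
    unfolding set_lebesgue_integral_def
    by (rule integral_dominated_convergence[OF f g w g_lim bound])
  then show "(\<lambda>n. LINT s:{u..v}|lborel. repulsion n s) \<longlonglongrightarrow> (LINT s:{u..v}|lborel. k / y s)"
    by (rule LIMSEQ_offset)
qed

lemma y_increment:
  assumes "0 \<le> u" "u \<le> v" and pos: "\<And>s. s \<in> {u..v} \<Longrightarrow> 0 < y s"
  shows "y v - y u =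
    1/2 * ((LINT s:{u..v}|lborel. k / y s) - a * (LINT s:{u..v}|lborel. y s)) + \<sigma>/2 * (b v - b u)"
proof (rule LIMSEQ_unique)
  show "(\<lambda>n. z n v - z n u) \<longlonglongrightarrow> y v - y u"
    using assms by (intro tendsto_intros lim) auto
  show "(\<lambda>n. z n v - z n u) \<longlonglongrightarrow>
    1/2 * ((LINT s:{u..v}|lborel. k / y s) - a * (LINT s:{u..v}|lborel. y s)) + \<sigma>/2 * (b v - b u)"
    unfolding z_increment[OF assms(1,2)]
    by (intro tendsto_intros lim_integral_repulsion lim_integral_z assms)
qed

text \<open>Once the nonnegative repulsion is dropped, the remaining terms converge without any
  positivity of \<open>y\<close>. The interval may therefore reach a zero of \<open>y\<close>, as is
  needed at the right end of an excursion.\<close>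

lemma y_increment_ge:
  assumes "0 \<le> u" "u \<le> v"
  shows "- (a/2 * (LINT s:{u..v}|lborel. y s)) + \<sigma>/2 * (b v - b u) \<le> y v - y u"
proof (rule LIMSEQ_le)
  show "(\<lambda>n. z n v - z n u) \<longlonglongrightarrow> y v - y u"
    using assms by (intro tendsto_intros lim) auto
  show "(\<lambda>n. - (a/2 * (LINT s:{u..v}|lborel. z n s)) + \<sigma>/2 * (b v - b u)) \<longlonglongrightarrow>
    - (a/2 * (LINT s:{u..v}|lborel. y s)) + \<sigma>/2 * (b v - b u)"
    by (intro tendsto_intros lim_integral_z assms)
  have "0 \<le> (LINT s:{u..v}|lborel. repulsion n s)" for n
    unfolding set_lebesgue_integral_def
    by (intro integral_nonneg_AE AE_I2) (simp add: repulsion_nonneg)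
  then show "\<exists>N. \<forall>n\<ge>N. - (a/2 * (LINT s:{u..v}|lborel. z n s)) + \<sigma>/2 * (b v - b u) \<le> z n v - z n u"
    unfolding z_increment[OF assms] by (auto simp: algebra_simps)
qed

section \<open>Continuity of the limit path inside excursions and at their endpoints\<close>

lemma y_continuous_on_positive:
  assumes "0 \<le> u" and pos: "\<And>s. s \<in> {u..v} \<Longrightarrow> 0 < y s"
  shows "continuous_on {u..v} y"
proof -
  have eq: "y u + (1/2 * ((LINT s:{u..t}|lborel. k / y s) - a * (LINT s:{u..t}|lborel. y s)) + \<sigma>/2 * (b t - b u)) = y t"
    if "t \<in> {u..v}" for t
    using y_increment[of u t] that assms by simp
  have "continuous_on {u..v} (\<lambda>t. y u + (1/2 * ((LINT s:{u..t}|lborel. k / y s)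
      - a * (LINT s:{u..t}|lborel. y s)) + \<sigma>/2 * (b t - b u)))"
    using assms by (intro continuous_intros continuous_on_set_lborel_integral inverse_y_integrable
        y_integrable continuous_on_subset[OF b_cont]) auto
  then show ?thesis
    by (rule continuous_on_eq) (rule eq)
qed

text \<open>Between the levels \<open>d/2\<close> and \<open>d\<close> the repulsion is at most \<open>2 * k / d\<close>, so every \<open>z n\<close> needs
  a time bounded below uniformly in \<open>n\<close> to climb from one to the other.\<close>

lemma y_le_at_right:
  assumes "0 \<le> \<alpha>" "y \<alpha> = 0" "0 < d"
  obtains \<tau> where "0 < \<tau>" "\<And>s. \<alpha> < s \<Longrightarrow> s < \<alpha> + \<tau> \<Longrightarrow> y s \<le> d"
proof -
  have "uniformly_continuous_on {\<alpha>..\<alpha>+1} b"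
    using assms by (intro compact_uniformly_continuous continuous_on_subset[OF b_cont]) auto
  then obtain \<rho> where "0 < \<rho>" and \<rho>: "\<And>s t. s \<in> {\<alpha>..\<alpha>+1} \<Longrightarrow> t \<in> {\<alpha>..\<alpha>+1} \<Longrightarrow>
      \<bar>t - s\<bar> < \<rho> \<Longrightarrow> \<bar>b t - b s\<bar> < d / (4 * \<sigma>)"
    using \<open>0 < d\<close> \<sigma> unfolding uniformly_continuous_on_def dist_real_def
    by (metis divide_pos_pos mult_pos_pos zero_less_numeral)
  \<comment> \<open>The three bounds keep \<open>t\<close> in \<open>{\<alpha>..\<alpha>+1}\<close>,
    the noise contribution below \<open>d/8\<close>, and the repulsion contribution at most
    \<open>d/8\<close>. Climbing from \<open>d/2\<close> to above \<open>d\<close> would need more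
    than \<open>d/2\<close>.\<close>
  define \<tau> where "\<tau> = min (min 1 \<rho>) (d\<^sup>2 / (8 * k))"
  have "0 < \<tau>"
    using \<open>0 < \<rho>\<close> \<open>0 < d\<close> k by (simp add: \<tau>_def)
  have "z n t \<le> d" if t: "\<alpha> < t" "t < \<alpha> + \<tau>" for n t
  proof (rule ccontr)
    assume "\<not> z n t \<le> d"
    then have neg: "d/2 - z n t < 0" using \<open>0 < d\<close> by simp
    have "z n \<alpha> \<le> d/2"
      using z_le_y[of \<alpha> n] assms by simp
    have "continuous_on {\<alpha>..t} (\<lambda>s. d/2 - z n s)"
      using assms by (intro continuous_intros continuous_on_subset[OF z_cont]) auto
    then obtain s where s: "\<alpha> \<le> s" "s < t" "d/2 - z n s = 0"
      and above: "\<And>r. s < r \<Longrightarrow> r \<le> t \<Longrightarrow> d/2 - z n r < 0"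
      by (rule last_crossing[where f = "\<lambda>s. d/2 - z n s"]) (use t neg \<open>z n \<alpha> \<le> d/2\<close> in auto)
    have ge: "d/2 \<le> z n r" if "r \<in> {s..t}" for r
      using that s(3) above[of r] by (cases "r = s") auto
    have "repulsion n r \<le> k / (d/2)" if "r \<in> {s..t}" for r
      unfolding repulsion_def using ge[OF that] k \<open>0 < d\<close> e_pos[of n]
      by (intro divide_left_mono) auto
    then have "(LINT r:{s..t}|lborel. repulsion n r) \<le> (LINT r:{s..t}|lborel. k / (d/2))"
      using s assms by (intro set_integral_mono repulsion_integrable borel_integrable_atLeastAtMost') auto
    also have "\<dots> = (t - s) * (k / (d/2))"
      using s by (simp add: set_lborel_integral_const)
    also have "\<dots> \<le> d\<^sup>2 / (8 * k) * (k / (d/2))"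
      using s t k \<open>0 < d\<close> by (intro mult_right_mono) (auto simp: \<tau>_def)
    also have "\<dots> = d/4"
      using k \<open>0 < d\<close> by (simp add: field_simps power2_eq_square)
    finally have 1: "(LINT r:{s..t}|lborel. repulsion n r) \<le> d/4" .
    have "(LINT r:{s..t}|lborel. 0) \<le> (LINT r:{s..t}|lborel. z n r)"
    proof (rule set_integral_mono[OF _ z_integrable])
      show "0 \<le> z n r" if "r \<in> {s..t}" for r
        using ge[OF that] \<open>0 < d\<close> by simp
    qed (use s assms in \<open>auto intro!: borel_integrable_atLeastAtMost'\<close>)
    then have 2: "0 \<le> a * (LINT r:{s..t}|lborel. z n r)"
      using a by simp
    have "\<bar>b t - b s\<bar> < d / (4 * \<sigma>)"
      using s t by (intro \<rho>) (auto simp: \<tau>_def)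
    then have "b t - b s < d / (4 * \<sigma>)"
      by simp
    then have "\<sigma> * (b t - b s) < d / 4"
      using \<sigma> by (simp add: field_simps)
    with 1 2 show False
      using z_increment[OF order_trans[OF assms(1) s(1)] less_imp_le[OF s(2)], of n] s(3)
        \<open>\<not> z n t \<le> d\<close> \<open>0 < d\<close> by argo
  qed
  then have "y t \<le> d" if "\<alpha> < t" "t < \<alpha> + \<tau>" for t
    using that assms by (intro LIMSEQ_le_const2[OF lim]) auto
  then show ?thesis
    using that \<open>0 < \<tau>\<close> by blast
qed

lemma y_tendsto_at_right:
  assumes "0 \<le> \<alpha>" "y \<alpha> = 0"
  shows "(y \<longlongrightarrow> 0) (at_right \<alpha>)"
proof (rule tendstoI)
  fix d :: real assume "0 < d"
  then obtain \<tau> where \<tau>: "0 < \<tau>" "\<And>s. \<alpha> < s \<Longrightarrow> s < \<alpha> + \<tau> \<Longrightarrow> y s \<le> d/2"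
    using y_le_at_right[OF assms, of "d/2"] by (metis half_gt_zero)
  show "\<forall>\<^sub>F s in at_right \<alpha>. dist (y s) 0 < d"
  proof (rule eventually_at_rightI[of \<alpha> "\<alpha> + \<tau>"])
    fix s assume "s \<in> {\<alpha><..<\<alpha> + \<tau>}"
    then show "dist (y s) 0 < d"
      using \<tau>(2)[of s] y_nonneg[of s] assms(1) \<open>0 < d\<close> by auto
  qed (use \<tau> in auto)
qed

text \<open>With \<open>y \<beta> = 0\<close>, the inequality \<open>y_increment_ge\<close> on
  \<open>{t..\<beta>}\<close> bounds \<open>y t\<close> by a continuous function \<open>h\<close>
  vanishing at \<beta>; nonnegativity gives the other side.\<close>

lemma y_tendsto_at_left:
  assumes "0 < \<beta>" "y \<beta> = 0"
  shows "(y \<longlongrightarrow> 0) (at_left \<beta>)"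
proof (rule tendsto_sandwich[OF _ _ tendsto_const])
  define h where "h t = a/2 * (LINT s:{t..\<beta>}|lborel. y s) - \<sigma>/2 * (b \<beta> - b t)" for t
  \<comment> \<open>Rewritten with the variable as upper limit, where continuity of indefinite
    integrals applies.\<close>
  have eq: "h t = a/2 * ((LINT s:{0..\<beta>}|lborel. y s) - (LINT s:{0..t}|lborel. y s)) - \<sigma>/2 * (b \<beta> - b t)"
    if "t \<in> {0..\<beta>}" for t
    using set_lborel_integral_combine[OF y_integrable[of 0 \<beta>], where v = t] that by (simp add: h_def)
  have "continuous_on {0..\<beta>} (\<lambda>t. a/2 * ((LINT s:{0..\<beta>}|lborel. y s) - (LINT s:{0..t}|lborel. y s)) - \<sigma>/2 * (b \<beta> - b t))"
    by (intro continuous_intros continuous_on_set_lborel_integral y_integrable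
        continuous_on_subset[OF b_cont]) auto
  then have "continuous_on {0..\<beta>} h"
    by (rule continuous_on_eq) (simp add: eq)
  then have "(h \<longlongrightarrow> h \<beta>) (at \<beta> within {0..\<beta>})"
    using assms by (auto simp: continuous_on_def)
  moreover have "h \<beta> = 0"
    using eq[of \<beta>] assms by simp
  ultimately show "(h \<longlongrightarrow> 0) (at_left \<beta>)"
    using assms by (simp add: at_within_Icc_at_left)
  show "\<forall>\<^sub>F t in at_left \<beta>. y t \<le> h t"
  proof (rule eventually_at_leftI[of 0])
    show "y t \<le> h t" if "t \<in> {0<..<\<beta>}" for t
      using y_increment_ge[of t \<beta>] that assms by (simp add: h_def)
  qed (rule assms)
  show "\<forall>\<^sub>F t in at_left \<beta>. 0 \<le> y t"
    using assms by (intro eventually_at_leftI[of 0]) (auto intro: y_nonneg)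
qed

section \<open>Closed excursions: the integral equation, the Stratonovich integral and the
  endpoints\<close>

context
  fixes \<alpha> \<beta>
  assumes ends: "0 \<le> \<alpha>" "\<alpha> < \<beta>" "y \<alpha> = 0" "y \<beta> = 0"
    and pos: "\<And>s. \<alpha> < s \<Longrightarrow> s < \<beta> \<Longrightarrow> 0 < y s"
begin

lemma y_continuous_on_excursion: "continuous_on {\<alpha>..\<beta>} y"
  unfolding continuous_on_eq_continuous_within
proof
  fix t assume t: "t \<in> {\<alpha>..\<beta>}"
  consider "t = \<alpha>" | "t = \<beta>" | "\<alpha> < t" "t < \<beta>"
    using t by fastforce
  then show "continuous (at t within {\<alpha>..\<beta>}) y"
  proof cases
    case 1
    then show ?thesis
      using y_tendsto_at_right[of \<alpha>] ends
      by (simp add: continuous_within at_within_Icc_at_right)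
  next
    case 2
    then show ?thesis
      using y_tendsto_at_left[of \<beta>] ends
      by (simp add: continuous_within at_within_Icc_at_left)
  next
    case 3
    have "continuous_on {(\<alpha> + t)/2..(t + \<beta>)/2} y"
      using 3 ends pos by (intro y_continuous_on_positive) auto
    then have "isCont y t"
      using 3 by (intro continuous_on_interior) auto
    then show ?thesis
      by (rule continuous_at_imp_continuous_at_within)
  qed
qed

text \<open>Monotone convergence towards the endpoints, in the form of the fundamental theorem of
  calculus for nonnegative integrands.\<close>

lemma
  assumes "\<alpha> \<le> u" "u \<le> v" "v \<le> \<beta>"
  shows inverse_y_integrable_excursion: "set_integrable lborel {u..v} (\<lambda>s. k / y s)"
    and y_increment_excursion: "y v - y u =
      1/2 * ((LINT s:{u..v}|lborel. k / y s) - a * (LINT s:{u..v}|lborel. y s)) + \<sigma>/2 * (b v - b u)"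
proof -
  \<comment> \<open>The equation solved for the repulsion: \<open>F\<close> has derivative
    \<open>k / y\<close> inside the excursion, yet its formula avoids \<open>k / y\<close> and is
    continuous up to both endpoints.\<close>
  define F where "F t = 2 * y t + a * (LINT s:{0..t}|lborel. y s) - \<sigma> * b t" for t
  have F_diff: "F t - F s = 2 * (y t - y s) + a * (LINT r:{s..t}|lborel. y r) - \<sigma> * (b t - b s)"
    if "0 \<le> s" "s \<le> t" for s t
    using set_lborel_integral_combine[OF y_integrable[of 0 t], where v = s] that
    by (simp add: F_def algebra_simps)
  have F_cont: "continuous_on {\<alpha>..\<beta>} F"
    unfolding F_def
    by (intro continuous_intros y_continuous_on_excursion continuous_on_subset[OF b_cont]
        continuous_on_subset[OF continuous_on_set_lborel_integral[OF y_integrable, of 0 \<beta>]])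
      (use ends in auto)
  have quot_cont: "isCont (\<lambda>s. k / y s) x" and F_deriv: "DERIV F x :> k / y x"
    if x: "\<alpha> < x" "x < \<beta>" for x
  proof -
    define p q where "p = (\<alpha> + x)/2" and "q = (x + \<beta>)/2"
    have pq: "0 \<le> p" "\<alpha> < p" "p < x" "x < q" "q < \<beta>"
      using x ends by (auto simp: p_def q_def)
    have pos_pq: "0 < y s" if "s \<in> {p..q}" for s
      using that pq by (intro pos) auto
    then have cont: "continuous_on {p..q} (\<lambda>s. k / y s)"
      using pq by (intro continuous_intros y_continuous_on_positive) (auto simp: less_imp_neq[symmetric])
    then show "isCont (\<lambda>s. k / y s) x"
      using pq by (intro continuous_on_interior) auto
    have "((\<lambda>t. F p + integral {p..t} (\<lambda>s. k / y s)) has_real_derivative 0 + k / y x) (at x within {p..q})"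
      using pq by (intro derivative_intros integral_has_real_derivative[OF cont]) auto
    moreover have "F p + integral {p..t} (\<lambda>s. k / y s) = F t" if "t \<in> {p..q}" for t
      using y_increment[of p t] F_diff[of p t] pq that pos_pq
        set_borel_integral_eq_integral(2)[OF inverse_y_integrable[of p t]] by (simp add: field_simps)
    ultimately have "(F has_real_derivative k / y x) (at x within {p..q})"
      using pq by (auto intro: has_field_derivative_transform_within[of _ _ _ _ 1])
    then show "DERIV F x :> k / y x"
      using pq by (simp add: at_within_Icc_at)
  qed
  have int: "set_integrable lborel {u..v} (\<lambda>s. k / y s) \<and> (LINT s:{u..v}|lborel. k / y s) = F v - F u"
  \<comment> \<open>The fundamental theorem used below requires \<open>u < v\<close>.\<close>
  proof (cases "u = v")
    case True
    then show ?thesis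
      using set_borel_integral_eq_integral(2)[of "{u..v}" "\<lambda>s. k / y s"] by simp
  next
    case False
    then have uv: "ereal u < ereal v" using assms by simp
    have D: "DERIV F x :> k / y x" "isCont (\<lambda>s. k / y s) x" if "ereal u < ereal x" "ereal x < ereal v" for x
      using that assms by (auto intro!: F_deriv quot_cont)
    have nonneg: "AE x in lborel. ereal u < ereal x \<longrightarrow> ereal x < ereal v \<longrightarrow> 0 \<le> k / y x"
      using k assms ends by (auto intro!: AE_I2 divide_nonneg_nonneg y_nonneg)
    have uvF: "continuous_on {u..v} F"
      using assms by (intro continuous_on_subset[OF F_cont]) auto
    have ends_lim: "(F \<longlongrightarrow> F u) (at u within {u..v})" "(F \<longlongrightarrow> F v) (at v within {u..v})"
      using uvF assms by (auto simp: continuous_on_def)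
    have A: "((F \<circ> real_of_ereal) \<longlongrightarrow> F u) (at_right (ereal u))"
      using ends_lim uv by (simp add: ereal_tendsto_simps at_within_Icc_at_right)
    have B: "((F \<circ> real_of_ereal) \<longlongrightarrow> F v) (at_left (ereal v))"
      using ends_lim uv by (simp add: ereal_tendsto_simps at_within_Icc_at_left)
    note FTC = interval_integral_FTC_nonneg[OF uv D nonneg A B]
    have "set_integrable lborel {u<..<v} (\<lambda>s. k / y s)"
      using FTC(1) by simp
    then have "set_integrable lborel ({u<..<v} \<union> ({u} \<union> {v})) (\<lambda>s. k / y s)"
      by (intro set_integrable_Un set_borel_integrable_singleton) auto
    moreover have "{u<..<v} \<union> ({u} \<union> {v}) = {u..v}"
      using assms by auto
    ultimately show ?thesis
      using FTC(2) assms by (simp add: interval_integral_Icc)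
  qed
  then show "set_integrable lborel {u..v} (\<lambda>s. k / y s)" ..
  show "y v - y u =
      1/2 * ((LINT s:{u..v}|lborel. k / y s) - a * (LINT s:{u..v}|lborel. y s)) + \<sigma>/2 * (b v - b u)"
    using int F_diff[of u v] assms ends by (simp add: field_simps)
qed

lemma excursion_stratonovich:
  assumes t: "t \<in> {\<alpha>..\<beta>}"
  shows "set_integrable lborel {\<alpha>..t} (\<lambda>s. k - a * (y s)\<^sup>2)"
    and "has_stratonovich_integral y b \<alpha> t (((y t)\<^sup>2 - (LINT s:{\<alpha>..t}|lborel. k - a * (y s)\<^sup>2)) / \<sigma>)"
proof -
  have cont: "continuous_on {\<alpha>..t} y"
    using t by (intro continuous_on_subset[OF y_continuous_on_excursion]) auto
  then show drift: "set_integrable lborel {\<alpha>..t} (\<lambda>s. k - a * (y s)\<^sup>2)"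
    by (intro borel_integrable_atLeastAtMost' continuous_intros)
  \<comment> \<open>The density left over when the equation is solved for the increments of
    \<open>b\<close>, with \<open>2/\<sigma>\<close> as the coefficient of the increments of
    \<open>y\<close>.\<close>
  let ?g = "\<lambda>s. 1/\<sigma> * (k / y s - a * y s)"
  have int: "set_integrable lborel {\<alpha>..t} ?g"
    using t ends inverse_y_integrable_excursion[of \<alpha> t] y_integrable[of \<alpha> t] by simp
  have inc: "b v - b u = 2/\<sigma> * (y v - y u) - (LINT s:{u..v}|lborel. ?g s)"
    if "\<alpha> \<le> u" "u \<le> v" "v \<le> t" for u v
  proof -
    have eq: "(LINT s:{u..v}|lborel. ?g s)
        = 1/\<sigma> * ((LINT s:{u..v}|lborel. k / y s) - a * (LINT s:{u..v}|lborel. y s))"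
      "y v - y u =
      1/2 * ((LINT s:{u..v}|lborel. k / y s) - a * (LINT s:{u..v}|lborel. y s)) + \<sigma>/2 * (b v - b u)"
      using that t ends inverse_y_integrable_excursion[of u v] y_integrable[of u v]
        y_increment_excursion[of u v] by simp_all
    have "D = 2/\<sigma> * (1/2 * J + \<sigma>/2 * D) - 1/\<sigma> * J" for D J
      using \<sigma> by (simp add: field_simps)
    then show ?thesis
      unfolding eq .
  qed
  have yg: "set_integrable lborel {\<alpha>..t} (\<lambda>s. y s * ?g s)"
    using t by (intro has_stratonovich_integral_of_increments(1)[OF cont _ int inc]) auto
  \<comment> \<open>At a zero of \<open>y\<close> the convention \<open>k / 0 = 0\<close> makes
    \<open>y s * ?g s\<close> vanish instead of equalling \<open>k / \<sigma>\<close>, so the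
    integrands agree only away from the endpoints.\<close>
  have "AE s in lborel. s \<notin> {\<alpha>, \<beta>}"
    by (intro AE_not_in countable_imp_null_set_lborel) auto
  then have "AE s in lborel. indicat_real {\<alpha>..t} s *\<^sub>R (y s * ?g s)
      = indicat_real {\<alpha>..t} s *\<^sub>R (1/\<sigma> * (k - a * (y s)\<^sup>2))"
  proof eventually_elim
    case (elim s)
    then show ?case
      using pos[of s] t by (auto simp: right_diff_distrib power2_eq_square split: split_indicator)
  qed
  then have "(LINT s:{\<alpha>..t}|lborel. y s * ?g s) = (LINT s:{\<alpha>..t}|lborel. 1/\<sigma> * (k - a * (y s)\<^sup>2))"
    using yg set_integrable_mult_right[of "1/\<sigma>" lborel "{\<alpha>..t}" "\<lambda>s. k - a * (y s)\<^sup>2"] drift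
    unfolding set_lebesgue_integral_def set_integrable_def
    by (intro integral_cong_AE borel_measurable_integrable) auto
  then have "(LINT s:{\<alpha>..t}|lborel. y s * ?g s) = 1/\<sigma> * (LINT s:{\<alpha>..t}|lborel. k - a * (y s)\<^sup>2)"
    by (simp only: set_integral_mult_right)
  moreover have "has_stratonovich_integral y b \<alpha> t
      (2/\<sigma> * ((y t)\<^sup>2 - (y \<alpha>)\<^sup>2) / 2 - (LINT s:{\<alpha>..t}|lborel. y s * ?g s))"
    using t by (intro has_stratonovich_integral_of_increments(2)[OF cont _ int inc]) auto
  ultimately show "has_stratonovich_integral y b \<alpha> t
      (((y t)\<^sup>2 - (LINT s:{\<alpha>..t}|lborel. k - a * (y s)\<^sup>2)) / \<sigma>)"
    using ends by (simp add: diff_divide_distrib)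
qed

end

text \<open>By maximality of components: an endpoint with positive value could be adjoined, giving a
  strictly larger connected subset of the positivity set. Together with \<open>y_nonneg\<close>,
  this forces the value 0 there.\<close>

lemma excursion_interval_endpoints:
  assumes "excursion_interval y \<alpha> \<beta>"
  shows "0 \<le> \<alpha>" "\<alpha> < \<beta>" "y \<alpha> = 0" "y \<beta> = 0" "\<And>s. \<alpha> < s \<Longrightarrow> s < \<beta> \<Longrightarrow> 0 < y s"
proof -
  have C: "{\<alpha><..<\<beta>} \<in> components (positivity_set y)"
    using assms by (simp add: excursion_interval_def)
  show "\<alpha> < \<beta>"
    using in_components_nonempty[OF C] by auto
  have sub: "s \<in> positivity_set y" if "\<alpha> < s" "s < \<beta>" for s
    using in_components_subset[OF C] that by auto
  show "0 < y s" if "\<alpha> < s" "s < \<beta>" for s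
    using sub[OF that] by (simp add: positivity_set_def)
  show "0 \<le> \<alpha>"
  proof (rule ccontr)
    assume "\<not> 0 \<le> \<alpha>"
    moreover obtain s where "\<alpha> < s" "s < min 0 \<beta>"
      using dense[of \<alpha> "min 0 \<beta>"] \<open>\<alpha> < \<beta>\<close> \<open>\<not> 0 \<le> \<alpha>\<close> by auto
    ultimately show False
      using sub[of s] by (auto simp: positivity_set_def)
  qed
  have "\<alpha> \<notin> positivity_set y"
  proof
    assume "\<alpha> \<in> positivity_set y"
    then have "{\<alpha>..<\<beta>} \<subseteq> positivity_set y"
      using sub by (auto simp: le_less)
    then have "{\<alpha>..<\<beta>} \<subseteq> {\<alpha><..<\<beta>}"
      using dense[OF \<open>\<alpha> < \<beta>\<close>] by (intro components_maximal[OF C]) auto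
    then show False
      using \<open>\<alpha> < \<beta>\<close> by auto
  qed
  then show "y \<alpha> = 0"
    using y_nonneg[of \<alpha>] \<open>0 \<le> \<alpha>\<close> by (auto simp: positivity_set_def)
  have "\<beta> \<notin> positivity_set y"
  proof
    assume "\<beta> \<in> positivity_set y"
    then have "{\<alpha><..\<beta>} \<subseteq> positivity_set y"
      using sub by (auto simp: le_less)
    then have "{\<alpha><..\<beta>} \<subseteq> {\<alpha><..<\<beta>}"
      using dense[OF \<open>\<alpha> < \<beta>\<close>] by (intro components_maximal[OF C]) auto
    then show False
      using \<open>\<alpha> < \<beta>\<close> by auto
  qed
  then show "y \<beta> = 0"
    using y_nonneg[of \<beta>] \<open>0 \<le> \<alpha>\<close> \<open>\<alpha> < \<beta>\<close> by (auto simp: positivity_set_def)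
qed

end

section \<open>From single paths to the almost sure statement\<close>

theorem theorem5p1:
  fixes M :: "'a measure"
    and B :: "real \<Rightarrow> 'a \<Rightarrow> real"
    and Yeps :: "real \<Rightarrow> real \<Rightarrow> 'a \<Rightarrow> real"
    and Y X :: "real \<Rightarrow> 'a \<Rightarrow> real"
    and H Y0 k a \<sigma> :: real
  assumes H: "0 < H" "H < 1/2"
    and B: "fractional_brownian_motion M H B"
    and pos: "Y0 > 0" "k > 0" "a > 0" "\<sigma> > 0"
    and Yeps: "\<And>\<epsilon> \<omega>. \<epsilon> > 0 \<Longrightarrow> \<omega> \<in> space M \<Longrightarrow>
      regularized_solution Y0 k a \<sigma> \<epsilon> (\<lambda>t. B t \<omega>) (\<lambda>t. Yeps \<epsilon> t \<omega>)"
    and Y: "AE \<omega> in M. \<forall>t\<ge>0. ((\<lambda>\<epsilon>. Yeps \<epsilon> t \<omega>) \<longlongrightarrow> Y t \<omega>) (at_right 0)"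
    and Y_int: "AE \<omega> in M. \<forall>T\<ge>0. set_integrable lborel {0..T} (\<lambda>t. Y t \<omega>)"
    and X: "\<And>t \<omega>. t \<ge> 0 \<Longrightarrow> \<omega> \<in> space M \<Longrightarrow> X t \<omega> = (Y t \<omega>)\<^sup>2"
  shows "AE \<omega> in M. \<forall>\<alpha> \<beta>. excursion_interval (\<lambda>t. Y t \<omega>) \<alpha> \<beta> \<longrightarrow>
    X \<alpha> \<omega> = 0 \<and>
    (\<forall>t\<in>{\<alpha>..\<beta>}.
      set_integrable lborel {\<alpha>..t} (\<lambda>s. k - a * X s \<omega>) \<and>
      (\<exists>I. has_stratonovich_integral (\<lambda>s. sqrt (X s \<omega>)) (\<lambda>s. B s \<omega>) \<alpha> t I \<and>
           X t \<omega> = (LINT s:{\<alpha>..t}|lborel. k - a * X s \<omega>) + \<sigma> * I))"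
proof -
  have cont: "B 0 \<omega> = 0" "continuous_on {0..} (\<lambda>t. B t \<omega>)" if "\<omega> \<in> space M" for \<omega>
    using B that by (auto simp: fractional_brownian_motion_def)
  \<comment> \<open>A positive sequence decreasing to 0 turns the one-sided limit in the
    regularisation parameter into a sequential one, as dominated convergence requires.\<close>
  let ?e = "\<lambda>n. inverse (real (Suc n))"
  have e_lim: "filterlim ?e (at_right 0) sequentially"
    by (intro tendsto_imp_filterlim_at_right LIMSEQ_inverse_real_of_nat) auto
  show ?thesis
    using Y Y_int AE_space
  proof eventually_elim
    case (elim \<omega>)
    interpret regularized_limit Y0 k a \<sigma> ?e "\<lambda>t. B t \<omega>" "\<lambda>t. Y t \<omega>" "\<lambda>n t. Yeps (?e n) t \<omega>"
    proof
      show "decseq ?e"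
        by (auto simp: decseq_def field_simps)
      show "?e \<longlonglongrightarrow> 0"
        by (rule LIMSEQ_inverse_real_of_nat)
      show "(\<lambda>n. Yeps (?e n) t \<omega>) \<longlonglongrightarrow> Y t \<omega>" if "0 \<le> t" for t
        by (rule filterlim_compose[OF elim(1)[rule_format, OF that] e_lim])
    qed (use pos cont elim Yeps in auto)
    show ?case
    proof (intro allI impI)
      fix \<alpha> \<beta> assume "excursion_interval (\<lambda>t. Y t \<omega>) \<alpha> \<beta>"
      note exc = excursion_interval_endpoints[OF this]
      have X_eq: "X s \<omega> = (Y s \<omega>)\<^sup>2" if "\<alpha> \<le> s" for s
        using X elim(3) exc(1) that by simp
      show "X \<alpha> \<omega> = 0 \<and> (\<forall>t\<in>{\<alpha>..\<beta>}.
        set_integrable lborel {\<alpha>..t} (\<lambda>s. k - a * X s \<omega>) \<and>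
        (\<exists>I. has_stratonovich_integral (\<lambda>s. sqrt (X s \<omega>)) (\<lambda>s. B s \<omega>) \<alpha> t I \<and>
           X t \<omega> = (LINT s:{\<alpha>..t}|lborel. k - a * X s \<omega>) + \<sigma> * I))"
      proof (intro conjI ballI)
        show "X \<alpha> \<omega> = 0"
          using X_eq exc by simp
        fix t assume t: "t \<in> {\<alpha>..\<beta>}"
        note S = excursion_stratonovich[OF exc t]
        show "set_integrable lborel {\<alpha>..t} (\<lambda>s. k - a * X s \<omega>)"
          using S(1) by (subst set_integrable_cong[OF refl refl]) (auto simp: X_eq)
        have int: "(LINT s:{\<alpha>..t}|lborel. k - a * X s \<omega>) = (LINT s:{\<alpha>..t}|lborel. k - a * (Y s \<omega>)\<^sup>2)"
          by (rule set_lebesgue_integral_cong) (auto simp: X_eq)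
        let ?I = "((Y t \<omega>)\<^sup>2 - (LINT s:{\<alpha>..t}|lborel. k - a * X s \<omega>)) / \<sigma>"
        \<comment> \<open>Nonnegativity of the path is what identifies the square root of
          \<open>X\<close> with \<open>Y\<close> rather than with its absolute value.\<close>
        have "has_stratonovich_integral (\<lambda>s. sqrt (X s \<omega>)) (\<lambda>s. B s \<omega>) \<alpha> t ?I"
          unfolding int using S(2)
          by (rule has_stratonovich_integral_cong) (use exc(1) in \<open>auto simp: X_eq y_nonneg\<close>)
        then show "\<exists>I. has_stratonovich_integral (\<lambda>s. sqrt (X s \<omega>)) (\<lambda>s. B s \<omega>) \<alpha> t I \<and>
           X t \<omega> = (LINT s:{\<alpha>..t}|lborel. k - a * X s \<omega>) + \<sigma> * I"
          using pos(4) t by (intro exI[of _ ?I]) (simp add: X_eq)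
      qed
    qed
  qed
qed

end
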